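(* Let $f(z)=\sum_{k\ge0}a_kz^k$ be a transcendental analytic function on (a neighbourhood of) $D_1$ with $f(0)=0$, $|f|\le1$ on $D_1$, and with rational Taylor coefficients $a_k$. Let $d\ge 1$ and let $\Delta$ be the absolute value of a non-zero minor determinant of size $(d^2+d)\times(d^2+d)$ of the matrix $\tilde M$ associated with $f$ and $d$. Then $$\Delta\ge h_{\nu_{2d}}^{-d^2(d+1)\nu_{2d}}.$$
   Context: $D_r=\{z\in\mathbb{C}:|z|\le r\}$. An analytic function $f$ is transcendental if $P(z,f(z))\not\equiv0$ for every non-zero $P\in\mathbb{C}[X,Y]$. Write $a_k=m_k/p_k$ with $m_k\in\mathbb{Z}$, $p_k\in\mathbb{Z}_{>0}$ coprime; for $l\ge1$ put $h_l=\max\{p_k: k=1,\dots,l\}$. The $d$-th transcendence index $\nu_d$ of $f$ is the maximal order of vanishing at $0$ of $P(z,f(z))$ over all non-zero $P\in\mathbb{C}[X,Y]$ of total degree at most $d$. For $i,j\in\mathbb{N}$ let $a_i^j$ be the $i$-th Taylor coefficient at $0$ of $f^j$. Let $b$ denote the Bautin index of the family $\sum_{0\le i,j\le d}\lambda_{j,i}z^if^j(z)$: writing this function as $\sum_k v_k(\lambda)z^k$ with $v_k$ linear forms in $\lambda\in\mathbb{C}^{(d+1)^2}$, $b$ is the smallest integer such that $v_0(\lambda)=\dots=v_b(\lambda)=0$ implies $\lambda=0$. The matrix $\tilde M$ is the $(b-d)\times(d^2+d)$ matrix whose rows are indexed by $k=d+1,\dots,b$, whose columns are indexed by pairs $(j,i)$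 with $1\le j\le d$, $0\le i\le d$ (ordered lexicographically), and whose entry in row $k$ and column $(j,i)$ is $a^j_{k-i}$. *)

theory Defs
  imports
    "HOL-Complex_Analysis.Complex_Analysis"
    "Jordan_Normal_Form.Determinant"
    "Jordan_Normal_Form.DL_Submatrix"
begin

(* A bivariate polynomial P(X, Y) is a polynomial in Y whose coefficients are polynomials in X:
   the coefficient of X^i Y^j is coeff (coeff P j) i. *)

definition poly2 :: "complex poly poly \<Rightarrow> complex \<Rightarrow> complex \<Rightarrow> complex" where
  "poly2 P x y = poly (poly P [:y:]) x"

definition total_degree_le :: "complex poly poly \<Rightarrow> nat \<Rightarrow> bool" where
  "total_degree_le P d \<longleftrightarrow> (\<forall>i j. coeff (coeff P j) i \<noteq> 0 \<longrightarrow> i + j \<le> d)"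

definition transcendental_on :: "complex set \<Rightarrow> (complex \<Rightarrow> complex) \<Rightarrow> bool" where
  "transcendental_on S f \<longleftrightarrow> (\<forall>P. P \<noteq> 0 \<longrightarrow> (\<exists>z\<in>S. poly2 P z (f z) \<noteq> 0))"

definition taylor_coeff :: "(complex \<Rightarrow> complex) \<Rightarrow> nat \<Rightarrow> complex" where
  "taylor_coeff g k = fps_nth (fps_expansion g 0) k"

(* The index of the first non-zero Taylor coefficient at 0. Only meaningful if g is analytic at 0
   and not identically zero near 0 (subdegree 0 = 0). *)
definition vanishing_order :: "(complex \<Rightarrow> complex) \<Rightarrow> nat" where
  "vanishing_order g = subdegree (fps_expansion g 0)"

(* For f transcendental and analytic near the closed unit disc the set of orders is finite and
   non-empty, and no P(z, f z) vanishes identically near 0, so that Max is a genuine maximum. *)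
definition transcendence_index :: "(complex \<Rightarrow> complex) \<Rightarrow> nat \<Rightarrow> nat" where
  "transcendence_index f d =
     Max {vanishing_order (\<lambda>z. poly2 P z (f z)) |P. P \<noteq> 0 \<and> total_degree_le P d}"

(* The linear form v_k; only the entries l j i with i, j \<le> d play a role. *)
definition family_coeff ::
    "(complex \<Rightarrow> complex) \<Rightarrow> nat \<Rightarrow> (nat \<Rightarrow> nat \<Rightarrow> complex) \<Rightarrow> nat \<Rightarrow> complex" where
  "family_coeff f d l k = taylor_coeff (\<lambda>z. \<Sum>j\<le>d. \<Sum>i\<le>d. l j i * z ^ i * f z ^ j) k"

definition bautin_index :: "(complex \<Rightarrow> complex) \<Rightarrow> nat \<Rightarrow> nat" where
  "bautin_index f d =
     (LEAST b. \<forall>l. (\<forall>k\<le>b. family_coeff f d l k = 0) \<longrightarrow> (\<forall>j\<le>d. \<forall>i\<le>d. l j i = 0))"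

(* Row r stands for the index k = d + 1 + r, and column c for the pair (j, i) with
   j = c div (d + 1) + 1 and i = c mod (d + 1), which enumerates the pairs with
   1 \<le> j \<le> d and 0 \<le> i \<le> d lexicographically. *)
definition bautin_matrix :: "(complex \<Rightarrow> complex) \<Rightarrow> nat \<Rightarrow> complex mat" where
  "bautin_matrix f d = Matrix.mat (bautin_index f d - d) (d\<^sup>2 + d)
     (\<lambda>(r, c). taylor_coeff (\<lambda>z. f z ^ (c div (d + 1) + 1)) (d + 1 + r - c mod (d + 1)))"

definition is_minor :: "nat \<Rightarrow> complex mat \<Rightarrow> complex \<Rightarrow> bool" where
  "is_minor n A x \<longleftrightarrow>
     (\<exists>I J. I \<subseteq> {..<dim_row A} \<and> J \<subseteq> {..<dim_col A} \<and> card I = n \<and> card J = n \<and>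
            x = Determinant.det (submatrix A I J))"

(* h_l for l \<ge> 1; quotient_of yields the reduced fraction with positive denominator. *)
definition max_denom :: "(nat \<Rightarrow> rat) \<Rightarrow> nat \<Rightarrow> int" where
  "max_denom a l = Max ((\<lambda>k. snd (quotient_of (a k))) ` {1..l})"

end

theory Submission
  imports Defs
begin

text \<open>
  Let \<open>b\<close> be the Bautin index, \<open>\<nu> = \<nu>\<^sub>2\<^sub>d\<close>, and let \<open>Q\<close> be the product of the denominators
  \<open>p\<^sub>1, \<dots>, p\<^sub>b\<close>. Since \<open>f 0 = 0\<close>, the entries of the Bautin matrix involve only \<open>a\<^sub>1, \<dots>, a\<^sub>b\<close>, in products
  of at most \<open>d\<close> factors, so multiplying the matrix by \<open>Q ^ d\<close> makes it integral. The minor thus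
  becomes a non-zero integer after multiplication by \<open>Q ^ (d * (d\<^sup>2 + d))\<close>. A non-zero family member is
  \<open>P (z, f z)\<close> with \<open>P\<close> of total degree at most \<open>2 * d\<close>, so it vanishes to order at most \<open>\<nu>\<close>; hence
  \<open>b \<le> \<nu>\<close> and \<open>Q \<le> h ^ \<nu>\<close>, where \<open>h\<close> is the maximum of \<open>p\<^sub>1, \<dots>, p\<^sub>\<nu>\<close>.
\<close>

section \<open>Orders of vanishing in finite-dimensional spaces of power series\<close>

text \<open>Adjoining one generator to a span adds at most one new order of vanishing, so induction
  on the generators applies. This is what makes the \<open>Max\<close> in
  \<open>transcendence_index\<close> a genuine maximum.\<close>

lemma finite_subdegree_span:
  fixes g :: "'s \<Rightarrow> 'a::field fps"
  assumes "finite S"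
  shows "finite (range (\<lambda>l. subdegree (\<Sum>s\<in>S. fps_const (l s) * g s)))"
  using assms
proof (induction S)
  case empty
  then show ?case by simp
next
  case (insert x S)
  define U where "U l = (\<Sum>s\<in>S. fps_const (l s) * g s)" for l
  define V where "V l = (\<Sum>s\<in>insert x S. fps_const (l s) * g s)" for l
  let ?W = "range (\<lambda>l. subdegree (U l))"
  have V: "V l = fps_const (l x) * g x + U l" for l
    unfolding U_def V_def using insert.hyps by simp
  \<comment> \<open>By convention the zero series has \<open>subdegree\<close> 0. This value already
    occurs on the smaller span, which settles the case \<open>V l = 0\<close> below.\<close>
  have zero: "0 \<in> ?W"
  proof -
    have "U (\<lambda>_. 0) = 0" by (simp add: U_def)
    then show ?thesis by (metis rangeI subdegree_0)
  qed
  \<comment> \<open>Two elements of the larger span whose orders differ and are not attained on the smaller span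
     would have a combination in the smaller span that attains the smaller of the two orders.\<close>
  have less: "subdegree (V l) \<in> ?W"
    if lt: "subdegree (V l) < subdegree (V l')" and notin: "subdegree (V l') \<notin> ?W" for l l'
  proof (cases "V l = 0")
    case True
    then show ?thesis using zero by simp
  next
    case False
    have l': "l' x \<noteq> 0"
    proof
      assume "l' x = 0"
      then have "V l' = U l'" by (simp add: V)
      then show False using notin by auto
    qed
    define w where "w = fps_const (l' x) * V l - fps_const (l x) * V l'"
    have "w = U (\<lambda>s. l' x * l s - l x * l' s)"
      unfolding w_def V U_def
      by (simp add: fps_eq_iff fps_sum_nth algebra_simps sum_subtractf sum_distrib_left)
    moreover have "subdegree w = subdegree (V l)"
    proof (rule subdegreeI)
      have w: "fps_nth w i = l' x * fps_nth (V l) i" if "i \<le> subdegree (V l)" for i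
      proof -
        have "fps_nth (V l') i = 0" using that lt by (intro nth_less_subdegree_zero) simp
        then show ?thesis unfolding w_def by simp
      qed
      show "fps_nth w (subdegree (V l)) \<noteq> 0"
        using w[OF order_refl] l' nth_subdegree_nonzero[OF False] by (simp only: mult_eq_0_iff) blast
      show "fps_nth w i = 0" if "i < subdegree (V l)" for i
        using w[of i] nth_less_subdegree_zero[OF that] that by simp
    qed
    ultimately show ?thesis by (metis rangeI)
  qed
  have "\<exists>m. range (\<lambda>l. subdegree (V l)) - ?W \<subseteq> {m}"
  proof (cases "range (\<lambda>l. subdegree (V l)) - ?W = {}")
    case False
    then obtain m where m: "m \<in> range (\<lambda>l. subdegree (V l)) - ?W" by blast
    have "n = m" if n: "n \<in> range (\<lambda>l. subdegree (V l)) - ?W" for n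
    proof -
      obtain l l' where "m = subdegree (V l)" "n = subdegree (V l')"
        using m n by blast
      then show ?thesis
        using less[of l l'] less[of l' l] m n by (cases m n rule: linorder_cases) auto
    qed
    then show ?thesis by blast
  qed auto
  then have "finite (range (\<lambda>l. subdegree (V l)) - ?W)"
    by (meson finite.simps finite_subset)
  moreover have "finite ?W" using insert.IH by (simp add: U_def)
  ultimately have "finite (range (\<lambda>l. subdegree (V l)))"
    using finite_Diff2 by blast
  then show ?case unfolding V_def .
qed

section \<open>Integrality of determinants and of coefficients of powers\<close>

lemma det_in_Ints:
  fixes A :: "'a::comm_ring_1 mat"
  assumes "A \<in> carrier_mat n n" "\<And>i j. i < n \<Longrightarrow> j < n \<Longrightarrow> A $$ (i, j) \<in> \<int>"
  shows "Determinant.det A \<in> \<int>"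
  unfolding Determinant.det_def'[OF assms(1)]
proof (intro Ints_sum Ints_mult Ints_prod)
  fix p assume "p \<in> {p. p permutes {0..<n}}"
  then show "A $$ (i, p i) \<in> \<int>" if "i \<in> {0..<n}" for i
    using assms(2) that permutes_in_image[of p "{0..<n}" i] by auto
qed (auto simp: sign_def)

text \<open>In the Cauchy product each of the \<open>j\<close> factors absorbs one \<open>q\<close>.
  Only coefficients of index at most \<open>m\<close> enter, so it is enough that \<open>q\<close>
  clears denominators up to \<open>n\<close>.\<close>

lemma fps_power_nth_in_Ints:
  fixes F :: "'a::comm_ring_1 fps"
  assumes "\<And>m. m \<le> n \<Longrightarrow> q * fps_nth F m \<in> \<int>" and "m \<le> n"
  shows "q ^ j * fps_nth (F ^ j) m \<in> \<int>"
  using assms(2)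
proof (induction j arbitrary: m)
  case 0
  then show ?case by (simp add: fps_one_nth)
next
  case (Suc j)
  have "q ^ Suc j * fps_nth (F ^ Suc j) m
      = (\<Sum>i=0..m. (q * fps_nth F i) * (q ^ j * fps_nth (F ^ j) (m - i)))"
    by (simp add: fps_mult_nth sum_distrib_left algebra_simps)
  also have "\<dots> \<in> \<int>"
    using Suc assms(1) by (intro Ints_sum Ints_mult[of "_ * _" "_ * _"]) auto
  finally show ?case .
qed

section \<open>Polynomials in z and f(z)\<close>

lemma poly_as_sum_le:
  fixes p :: "'a::comm_semiring_1 poly"
  assumes "degree p \<le> n"
  shows "poly p x = (\<Sum>i\<le>n. coeff p i * x ^ i)"
  unfolding poly_altdef using assms
  by (intro sum.mono_neutral_left) (auto simp: coeff_eq_0)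

lemma poly2_as_sum:
  assumes "\<And>i j. coeff (coeff P j) i \<noteq> 0 \<Longrightarrow> i \<le> n \<and> j \<le> n"
  shows "poly2 P x y = (\<Sum>j\<le>n. \<Sum>i\<le>n. coeff (coeff P j) i * x ^ i * y ^ j)"
proof -
  have "degree (coeff P j) \<le> n" for j
    using assms by (meson degree_le leI not_less)
  moreover have "degree P \<le> n"
  proof (rule degree_le, intro allI impI)
    fix j assume "n < j"
    then have "coeff (coeff P j) i = 0" for i using assms by force
    then show "coeff P j = 0" by (simp add: poly_eq_iff)
  qed
  ultimately show ?thesis
    unfolding poly2_def
    by (simp add: poly_as_sum_le[of P n] poly_as_sum_le[of "coeff P _" n] poly_sum
        poly_const_pow sum_distrib_left mult.commute)
qed

text \<open>Turns a member of the Bautin family into a polynomial. Both exponents are at most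
  \<open>d\<close>, so the total degree is at most \<open>2 * d\<close>; this is where the index
  \<open>2 * d\<close> comes from.\<close>

lemma obtain_poly2:
  fixes l :: "nat \<Rightarrow> nat \<Rightarrow> complex"
  obtains P where "\<And>i j. coeff (coeff P j) i = (if i \<le> d \<and> j \<le> d then l j i else 0)"
    "total_degree_le P (2 * d)"
    "\<And>x y. poly2 P x y = (\<Sum>j\<le>d. \<Sum>i\<le>d. l j i * x ^ i * y ^ j)"
proof -
  define P :: "complex poly poly"
    where "P = (\<Sum>j\<le>d. Polynomial.monom (\<Sum>i\<le>d. Polynomial.monom (l j i) i) j)"
  have coeffP: "coeff (coeff P j) i = (if i \<le> d \<and> j \<le> d then l j i else 0)" for i j
    by (simp add: P_def coeff_sum)
  show ?thesis
  proof
    show "coeff (coeff P j) i = (if i \<le> d \<and> j \<le> d then l j i else 0)" for i j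
      by (fact coeffP)
    show "total_degree_le P (2 * d)"
      by (auto simp: total_degree_le_def coeffP split: if_splits)
    show "poly2 P x y = (\<Sum>j\<le>d. \<Sum>i\<le>d. l j i * x ^ i * y ^ j)" for x y
      by (subst poly2_as_sum[of _ d]) (auto simp: coeffP split: if_splits)
  qed
qed

lemma fps_expansion_eqI:
  assumes "f has_fps_expansion F"
  shows "fps_expansion f 0 = F"
  using fps_nth_fps_expansion[OF assms] by (simp add: fps_eq_iff fps_expansion_def)

lemma fps_expansion_family:
  assumes "f has_fps_expansion F"
  shows "fps_expansion (\<lambda>z. \<Sum>j\<le>n. \<Sum>i\<le>n. l j i * z ^ i * f z ^ j) 0
      = (\<Sum>j\<le>n. \<Sum>i\<le>n. fps_const (l j i) * fps_X ^ i * F ^ j)"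
  by (intro fps_expansion_eqI fps_expansion_intros assms)

text \<open>Total degree at most \<open>n\<close> bounds both exponents by \<open>n\<close>, so all
  the expansions lie in the span of the finitely many products \<open>fps_X ^ i * F ^ j\<close> with
  \<open>i, j \<le> n\<close>.\<close>

lemma finite_vanishing_orders:
  assumes "f analytic_on {0}"
  shows "finite {vanishing_order (\<lambda>z. poly2 P z (f z)) |P. P \<noteq> 0 \<and> total_degree_le P n}"
proof -
  have F: "f has_fps_expansion fps_expansion f 0" (is "_ has_fps_expansion ?F")
    using assms by (rule analytic_at_imp_has_fps_expansion_0)
  let ?g = "\<lambda>(j, i). fps_X ^ i * ?F ^ j :: complex fps"
  let ?S = "{..n} \<times> {..n}"
  have "finite (range (\<lambda>l. subdegree (\<Sum>s\<in>?S. fps_const (l s) * ?g s)))"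
    by (intro finite_subdegree_span) auto
  then show ?thesis
  proof (rule rev_finite_subset, intro subsetI)
    fix k assume "k \<in> {vanishing_order (\<lambda>z. poly2 P z (f z)) |P. P \<noteq> 0 \<and> total_degree_le P n}"
    then obtain P where k: "k = vanishing_order (\<lambda>z. poly2 P z (f z))" and "total_degree_le P n"
      by blast
    then have "i \<le> n \<and> j \<le> n" if "coeff (coeff P j) i \<noteq> 0" for i j
      using that unfolding total_degree_le_def by (meson add_leD1 add_leD2)
    then have "k = subdegree (\<Sum>j\<le>n. \<Sum>i\<le>n. fps_const (coeff (coeff P j) i) * fps_X ^ i * ?F ^ j)"
      unfolding k vanishing_order_def by (simp add: poly2_as_sum[of P n] fps_expansion_family[OF F])
    also have "\<dots> = subdegree (\<Sum>s\<in>?S. fps_const ((\<lambda>(j, i). coeff (coeff P j) i) s) * ?g s)"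
      by (simp add: sum.cartesian_product case_prod_unfold mult.assoc)
    finally show "k \<in> range (\<lambda>l. subdegree (\<Sum>s\<in>?S. fps_const (l s) * ?g s))" by blast
  qed
qed

text \<open>A zero expansion would force vanishing on the open disc by analytic continuation, then
  on the boundary circle by continuity. Transcendence on the closed disc excludes this.\<close>

lemma poly2_expansion_nonzero:
  assumes an: "f analytic_on cball 0 1" and tr: "transcendental_on (cball 0 1) f" and "P \<noteq> 0"
  shows "fps_expansion (\<lambda>z. poly2 P z (f z)) 0 \<noteq> 0"
proof
  define g where "g z = poly2 P z (f z)" for z
  assume "fps_expansion (\<lambda>z. poly2 P z (f z)) 0 = 0"
  then have g0: "fps_expansion g 0 = 0" by (simp add: g_def[abs_def])
  have g: "g analytic_on cball 0 1"
    unfolding g_def poly2_def poly_altdef[of P] poly_sum poly_mult poly_const_pow poly_altdef[of "coeff P _"]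
    by (simp add: poly_const_pow) (intro analytic_intros an)
  then have "g analytic_on {0}" by (rule analytic_on_subset) auto
  then have "g has_fps_expansion 0"
    using analytic_at_imp_has_fps_expansion_0[of g] g0 by simp
  then have "g z = 0" if "z \<in> ball 0 1" for z
  proof (rule has_fps_expansion_0_analytic_continuation)
    show "g holomorphic_on ball 0 1"
      using g analytic_imp_holomorphic analytic_on_subset ball_subset_cball by blast
  qed (use that in auto)
  moreover have "continuous_on (closure (ball 0 1)) g"
    using g by (simp add: analytic_imp_holomorphic holomorphic_on_imp_continuous_on)
  ultimately have "g z = 0" if "z \<in> closure (ball 0 1)" for z
    using continuous_constant_on_closure that by blast
  then show False
    using tr \<open>P \<noteq> 0\<close> unfolding transcendental_on_def g_def by auto
qed

section \<open>Comparison of the Bautin index with the transcendence index\<close>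

lemma bautin_index_le_transcendence_index:
  assumes an: "f analytic_on cball 0 1" and tr: "transcendental_on (cball 0 1) f"
  shows "bautin_index f d \<le> transcendence_index f (2 * d)"
proof -
  have an0: "f analytic_on {0}" using an by (rule analytic_on_subset) auto
  define \<nu> where "\<nu> = transcendence_index f (2 * d)"
  define H where "H l = fps_expansion (\<lambda>z. \<Sum>j\<le>d. \<Sum>i\<le>d. l j i * z ^ i * f z ^ j) 0" for l
  define Q where "Q b \<longleftrightarrow> (\<forall>l. (\<forall>k\<le>b. family_coeff f d l k = 0) \<longrightarrow> (\<forall>j\<le>d. \<forall>i\<le>d. l j i = 0))" for b
  have coeff: "family_coeff f d l k = fps_nth (H l) k" for l k
    by (simp add: family_coeff_def taylor_coeff_def H_def)
  \<comment> \<open>The bound on \<open>subdegree\<close> alone would be vacuous for the zero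
    series. Together with \<open>H l \<noteq> 0\<close> it yields a non-zero coefficient of index at
    most \<nu>.\<close>
  have order: "H l \<noteq> 0 \<and> subdegree (H l) \<le> \<nu>" if nz: "\<not> (\<forall>j\<le>d. \<forall>i\<le>d. l j i = 0)" for l
  proof -
    obtain P where P: "\<And>i j. coeff (coeff P j) i = (if i \<le> d \<and> j \<le> d then l j i else 0)"
      "total_degree_le P (2 * d)"
      "\<And>x y. poly2 P x y = (\<Sum>j\<le>d. \<Sum>i\<le>d. l j i * x ^ i * y ^ j)"
      using obtain_poly2[of d l] by blast
    have "P \<noteq> 0" using nz P(1) by (metis coeff_0)
    have H: "H l = fps_expansion (\<lambda>z. poly2 P z (f z)) 0" by (simp add: H_def P(3))
    then have "H l \<noteq> 0" using poly2_expansion_nonzero[OF an tr \<open>P \<noteq> 0\<close>] by simp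
    moreover have "subdegree (H l) \<le> \<nu>"
      unfolding \<nu>_def transcendence_index_def
      using \<open>P \<noteq> 0\<close> P(2) H
      by (intro Max_ge finite_vanishing_orders an0) (auto simp: vanishing_order_def)
    ultimately show ?thesis by simp
  qed
  have "Q \<nu>"
    unfolding Q_def
  proof (intro allI impI, rule ccontr)
    fix l j i assume "\<forall>k\<le>\<nu>. family_coeff f d l k = 0" "j \<le> d" "i \<le> d" "l j i \<noteq> 0"
    then show False using order[of l] by (metis coeff nth_subdegree_nonzero)
  qed
  then have "bautin_index f d \<le> \<nu>"
    unfolding bautin_index_def Q_def[symmetric] by (rule Least_le)
  then show ?thesis by (simp add: \<nu>_def)
qed


section \<open>Denominators of the Taylor coefficients\<close>

lemma max_denom_ge_1:
  assumes "n \<ge> 1"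
  shows "max_denom a n \<ge> 1"
proof -
  have "snd (quotient_of (a 1)) \<le> max_denom a n"
    unfolding max_denom_def using assms by (intro Max_ge) auto
  then show ?thesis using quotient_of_denom_pos'[of "a 1"] by linarith
qed

text \<open>There are \<open>b\<close> factors, each at most the maximum; since the maximum is at
  least 1, the exponent can be raised from \<open>b\<close> to \<open>n\<close>.\<close>

lemma prod_denom_le_max_denom_power:
  assumes "b \<le> n" "n \<ge> 1"
  shows "(\<Prod>k=1..b. snd (quotient_of (a k))) \<le> max_denom a n ^ n"
proof -
  have "snd (quotient_of (a k)) \<le> max_denom a n" if "k \<in> {1..b}" for k
    unfolding max_denom_def using that assms by (intro Max_ge) auto
  then have "(\<Prod>k=1..b. snd (quotient_of (a k))) \<le> (\<Prod>k=1..b. max_denom a n)"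
    by (intro prod_mono) (auto simp: quotient_of_denom_pos' less_imp_le)
  also have "\<dots> = max_denom a n ^ b" by simp
  also have "\<dots> \<le> max_denom a n ^ n"
    using max_denom_ge_1[OF assms(2)] assms(1) by (intro power_increasing) auto
  finally show ?thesis .
qed

lemma prod_denom_mult_in_Ints:
  fixes a :: "nat \<Rightarrow> rat"
  assumes "k \<in> {1..b}"
  shows "of_int (\<Prod>k=1..b. snd (quotient_of (a k))) * (of_rat (a k) :: 'a::field_char_0) \<in> \<int>"
proof -
  obtain m p where mp: "quotient_of (a k) = (m, p)" by fastforce
  have p: "p > 0" using mp by (rule quotient_of_denom_pos)
  have "(of_rat (a k) :: 'a) = of_int m / of_int p"
    using quotient_of_div[OF mp] by (simp add: of_rat_divide)
  then have "of_int p * (of_rat (a k) :: 'a) = of_int m" using p by simp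
  moreover have "(\<Prod>k=1..b. snd (quotient_of (a k)))
      = (\<Prod>k\<in>{1..b} - {k}. snd (quotient_of (a k))) * p"
    using assms mp by (subst prod.remove[of "{1..b}" k]) auto
  ultimately show ?thesis by (simp add: mult.assoc Ints_mult Ints_prod)
qed

section \<open>Lower bound for the non-zero minors\<close>

theorem proposition3p2p7:
  fixes f :: "complex \<Rightarrow> complex" and a :: "nat \<Rightarrow> rat" and d :: nat
    and \<delta> :: complex and \<Delta> :: real
  assumes "f analytic_on cball 0 1"
    and "transcendental_on (cball 0 1) f"
    and "\<And>z. z \<in> cball 0 1 \<Longrightarrow> (\<lambda>k. of_rat (a k) * z ^ k) sums f z"
    and "f 0 = 0"
    and "\<And>z. z \<in> cball 0 1 \<Longrightarrow> cmod (f z) \<le> 1"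
    and "d \<ge> 1"
    and "is_minor (d\<^sup>2 + d) (bautin_matrix f d) \<delta>"
    and "\<delta> \<noteq> 0"
    and "\<Delta> = cmod \<delta>"
  shows "\<Delta> \<ge> real_of_int (max_denom a (transcendence_index f (2 * d)))
              powi (- int (d\<^sup>2 * (d + 1) * transcendence_index f (2 * d)))"
proof -
  define \<nu> where "\<nu> = transcendence_index f (2 * d)"
  define b where "b = bautin_index f d"
  define h where "h = max_denom a \<nu>"
  define n where "n = d\<^sup>2 + d"
  define q where "q = (\<Prod>k=1..b. snd (quotient_of (a k)))"
  define F :: "complex fps" where "F = Abs_fps (\<lambda>k. of_rat (a k))"
  have "b \<le> \<nu>"
    unfolding b_def \<nu>_def using assms(1,2) by (rule bautin_index_le_transcendence_index)
  have q: "q \<ge> 1"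
    unfolding q_def by (intro prod_ge_1) (use quotient_of_denom_pos' in \<open>simp add: int_one_le_iff_zero_less\<close>)

  \<comment> \<open>Uniqueness of the expansion identifies the \<open>a k\<close> with the Taylor
    coefficients of \<open>f\<close>, so matrix entries become coefficients of powers of
    \<open>F\<close>.\<close>
  have F: "f has_fps_expansion F"
  proof (rule has_fps_expansionI)
    have "eventually (\<lambda>u. u \<in> ball 0 1) (nhds (0::complex))"
      by (intro eventually_nhds_in_open) auto
    then show "eventually (\<lambda>u. (\<lambda>k. fps_nth F k * u ^ k) sums f u) (nhds 0)"
      by eventually_elim (use assms(3) in \<open>auto simp: F_def\<close>)
  qed
  \<comment> \<open>The product \<open>q\<close> starts at index 1; the coefficient of index 0 is
    covered because it vanishes.\<close>
  have "fps_nth F 0 = 0"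
    using has_fps_expansion_imp_0_eq_fps_nth_0[OF F] assms(4) by simp
  moreover have "of_int q * fps_nth F k \<in> \<int>" if "k \<in> {1..b}" for k
    unfolding q_def F_def fps_nth_Abs_fps using that by (rule prod_denom_mult_in_Ints)
  ultimately have qF: "of_int q * fps_nth F k \<in> \<int>" if "k \<le> b" for k
    using that by (cases "k = 0") auto

  have entry: "of_int q ^ d * bautin_matrix f d $$ (r, c) \<in> \<int>" if rc: "r < b - d" "c < n" for r c
  proof -
    \<comment> \<open>From \<open>c < d * (d + 1)\<close> follows \<open>j \<le> d\<close>, and from
      \<open>r < b - d\<close> that the row index \<open>d + 1 + r\<close> is at most
      \<open>b\<close>. The remainder is at most \<open>d\<close>, so the subtraction in
      \<open>k\<close> is not truncated.\<close>
    define j where "j = c div (d + 1) + 1"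
    define k where "k = d + 1 + r - c mod (d + 1)"
    have "j \<le> d"
      using rc(2) less_mult_imp_div_less[of c d "d + 1"]
      by (simp add: j_def n_def power2_eq_square)
    have "k \<le> b" using rc(1) by (simp add: k_def)
    have "bautin_matrix f d $$ (r, c) = fps_nth (F ^ j) k"
      using rc fps_expansion_eqI[OF has_fps_expansion_power[OF F, of j]]
      unfolding bautin_matrix_def taylor_coeff_def b_def n_def j_def k_def
      by (simp del: power_Suc)
    \<comment> \<open>The entry needs only \<open>q ^ j\<close>; the surplus
      \<open>q ^ (d - j)\<close> gives all columns the same multiplier.\<close>
    then have "of_int q ^ d * bautin_matrix f d $$ (r, c)
        = of_int q ^ (d - j) * (of_int q ^ j * fps_nth (F ^ j) k)"
      using \<open>j \<le> d\<close> by (simp flip: power_add)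
    also have "\<dots> \<in> \<int>"
      by (intro Ints_mult[OF _ fps_power_nth_in_Ints[OF qF \<open>k \<le> b\<close>]] Ints_power) auto
    finally show ?thesis .
  qed

  obtain I J where IJ: "I \<subseteq> {..<b - d}" "J \<subseteq> {..<n}" "card I = n" "card J = n"
    and \<delta>: "\<delta> = Determinant.det (submatrix (bautin_matrix f d) I J)"
    using assms(7) by (auto simp: is_minor_def bautin_matrix_def b_def n_def)
  define S where "S = submatrix (bautin_matrix f d) I J"
  have dims: "dim_row (bautin_matrix f d) = b - d" "dim_col (bautin_matrix f d) = n"
    by (auto simp: bautin_matrix_def b_def n_def)
  have cards: "{i. i < b - d \<and> i \<in> I} = I" "{j. j < n \<and> j \<in> J} = J"
    using IJ by auto
  have S: "S \<in> carrier_mat n n"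
    unfolding S_def carrier_mat_def by (simp add: dim_submatrix dims cards IJ)
  have "Determinant.det (of_int q ^ d \<cdot>\<^sub>m S) \<in> \<int>"
  proof (rule det_in_Ints)
    fix r c assume rc: "r < n" "c < n"
    have "pick I r \<in> I" "pick J c \<in> J"
      using rc IJ(3,4) by (auto intro: pick_in_set_le)
    then have "pick I r < b - d" "pick J c < n" using IJ by auto
    moreover have "S $$ (r, c) = bautin_matrix f d $$ (pick I r, pick J c)"
      unfolding S_def using rc IJ by (subst submatrix_index) (auto simp: dims cards)
    ultimately show "(of_int q ^ d \<cdot>\<^sub>m S) $$ (r, c) \<in> \<int>"
      using rc S entry by auto
  qed (use S in auto)
  \<comment> \<open>Scaling each of the \<open>n\<close> rows by \<open>q ^ d\<close> contributes
    the factor \<open>(q ^ d) ^ n\<close>.\<close>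
  moreover have "Determinant.det (of_int q ^ d \<cdot>\<^sub>m S) = of_int q ^ (d * n) * \<delta>"
    using S by (simp add: \<delta> S_def power_mult)
  ultimately obtain z where z: "of_int q ^ (d * n) * \<delta> = of_int z"
    by (auto elim: Ints_cases)
  then have "z \<noteq> 0" using q assms(8) by auto
  then have "1 \<le> cmod (of_int z)" by simp
  also have "cmod (of_int z) = real_of_int q ^ (d * n) * \<Delta>"
    using q by (simp flip: z add: norm_mult norm_power assms(9))
  finally have *: "1 \<le> real_of_int q ^ (d * n) * \<Delta>" .

  \<comment> \<open>A minor of positive size needs a row, so \<open>b > d\<close> and hence \<nu> is
    positive. Thus the \<open>Max\<close> in \<open>max_denom a \<nu>\<close> ranges over a
    non-empty set.\<close>
  have "n > 0" using assms(6) by (simp add: n_def)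
  then have "I \<noteq> {}" using IJ(3) by auto
  then have "\<nu> \<ge> 1" using IJ(1) \<open>b \<le> \<nu>\<close> by auto
  then have h: "h \<ge> 1" and "q \<le> h ^ \<nu>"
    unfolding h_def q_def using \<open>b \<le> \<nu>\<close>
    by (simp_all add: max_denom_ge_1 prod_denom_le_max_denom_power del: One_nat_def)
  then have "real_of_int q ^ (d * n) \<le> (real_of_int h ^ \<nu>) ^ (d * n)"
    using q by (intro power_mono) (simp_all flip: of_int_power)
  \<comment> \<open>Since \<open>n = d * (d + 1)\<close>, the exponent
    \<open>\<nu> * (d * n)\<close> is the one claimed.\<close>
  also have "\<dots> = real_of_int h ^ (d\<^sup>2 * (d + 1) * \<nu>)"
    by (simp flip: power_mult add: n_def power2_eq_square algebra_simps)
  finally have "1 \<le> real_of_int h ^ (d\<^sup>2 * (d + 1) * \<nu>) * \<Delta>"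
    using * assms(9) by (meson mult_right_mono norm_ge_zero order_trans)
  then have "inverse (real_of_int h ^ (d\<^sup>2 * (d + 1) * \<nu>)) \<le> \<Delta>"
    using h by (simp add: field_simps)
  then show ?thesis
    unfolding power_int_minus power_int_of_nat h_def \<nu>_def .
qed

end
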